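(* Let $n\geq 2$ be an integer and let $k>2$ be an odd integer. Then $P_k^{r,r+1}(n-1)$ is Eulerian for every $r\in\mathbb{Z}$ satisfying $n\leq r<(k-1)n$.
   Context: A $k$-ary $n$-tuple is an element of $\mathbb{Z}_k^n$, with entries identified with the integers $0,1,\dots,k-1$. The de Bruijn digraph $B_k(n-1)$ has vertex set $\mathbb{Z}_k^{n-1}$, and its edges are identified with the $k$-ary $n$-tuples: the $n$-tuple $(x_0,\dots,x_{n-1})$ is the edge from vertex $(x_0,\dots,x_{n-2})$ to vertex $(x_1,\dots,x_{n-1})$ (loops allowed). A subgraph "consisting of" a set of edges has exactly those edges, and its vertices are the vertices incident with at least one of them. A digraph is Eulerian if it is strongly connected (there is a directed path between any ordered pair of its vertices) and balanced (every vertex has in-degree equal to out-degree). Define $f:\mathbb{Z}_k\to\mathbb{Q}$ by $f(a)=a$ (as an integer in $[0,k-1]$) if $a\neq 0$, and $f(0)=k/2$. The pseudoweight of a $k$-ary $n$-tuple $\mathbf{a}=(a_0,\dots,a_{n-1})$ is $w_p(\mathbf{a})=\sum_{i=0}^{n-1}f(a_i)$, computed in $\mathbb{Q}$ (so for odd $k$ it may be a half-integer). For $0\leq r\leq s\leq (k-1)n$, $P_k^{r,s}(n-1)$ is the subgraph of $B_k(n-1)$ consisting of the edges corresponding to $n$-tuples $\mathbf{a}$ with $r\leq w_p(\mathbf{a})\leq s$. *)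

theory Defs
  imports Complex_Main "Graph_Theory.Graph_Theory"
begin

(* Z_k is represented by the naturals below k, and a tuple over Z_k by a list. *)
definition tuples :: "nat \<Rightarrow> nat \<Rightarrow> nat list set" where
  "tuples k n = {xs. length xs = n \<and> set xs \<subseteq> {..<k}}"

(* de_bruijn k m is B_k(m): the vertices are the m-tuples, the edges the (m+1)-tuples. *)
definition de_bruijn :: "nat \<Rightarrow> nat \<Rightarrow> (nat list, nat list) pre_digraph" where
  "de_bruijn k m = \<lparr>verts = tuples k m, arcs = tuples k (Suc m), tail = butlast, head = tl\<rparr>"

definition edge_subgraph :: "('a, 'b) pre_digraph \<Rightarrow> 'b set \<Rightarrow> ('a, 'b) pre_digraph" where
  "edge_subgraph G A =
     \<lparr>verts = tail G ` A \<union> head G ` A, arcs = A, tail = tail G, head = head G\<rparr>"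

definition balanced :: "('a, 'b) pre_digraph \<Rightarrow> bool" where
  "balanced G \<longleftrightarrow> (\<forall>v\<in>verts G. in_degree G v = out_degree G v)"

(* strongly_connected in Graph_Theory also requires a nonempty vertex set. *)
definition eulerian :: "('a, 'b) pre_digraph \<Rightarrow> bool" where
  "eulerian G \<longleftrightarrow> strongly_connected G \<and> balanced G"

definition pseudovalue :: "nat \<Rightarrow> nat \<Rightarrow> rat" where
  "pseudovalue k a = (if a = 0 then of_nat k / 2 else of_nat a)"

definition pseudoweight :: "nat \<Rightarrow> nat list \<Rightarrow> rat" where
  "pseudoweight k xs = (\<Sum>i<length xs. pseudovalue k (xs ! i))"

(* pseudoweight_graph k r s m is P_k^{r,s}(m), a subgraph of B_k(m). *)
definition pseudoweight_graph ::
  "nat \<Rightarrow> int \<Rightarrow> int \<Rightarrow> nat \<Rightarrow> (nat list, nat list) pre_digraph" where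
  "pseudoweight_graph k r s m =
     edge_subgraph (de_bruijn k m)
       {xs \<in> arcs (de_bruijn k m). of_int r \<le> pseudoweight k xs \<and> pseudoweight k xs \<le> of_int s}"

lemma wf_digraph_de_bruijn: "wf_digraph (de_bruijn k m)"
  by unfold_locales
    (auto simp: de_bruijn_def tuples_def dest: in_set_butlastD list.set_sel(2)[rotated])

lemma subgraph_edge_subgraph:
  assumes "wf_digraph G" and "A \<subseteq> arcs G"
  shows "subgraph (edge_subgraph G A) G"
proof -
  interpret wf_digraph G by fact
  have "wf_digraph (edge_subgraph G A)"
    by unfold_locales (auto simp: edge_subgraph_def)
  then show ?thesis
    using assms by (auto simp: subgraph_def edge_subgraph_def compatible_def)
qed

lemma subgraph_pseudoweight_graph: "subgraph (pseudoweight_graph k r s m) (de_bruijn k m)"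
  unfolding pseudoweight_graph_def
  by (intro subgraph_edge_subgraph wf_digraph_de_bruijn) auto

end

theory Submission
  imports Defs
begin

(* In twice the pseudoweight every digit contributes an integer. The rotations of a tuple have the
   same pseudoweight and form a closed walk, so reachability between edges is symmetric, and
   connectivity reduces to connecting tuples by changing one digit at a time.
   For odd k, a zero can always be replaced by (k - 1)/2 or (k + 1)/2 without leaving the interval
   [r, r + 1]. Two distinct zero-free tuples have digit sums in {r, r + 1}, and at a position where
   they differ one of them can be moved one unit towards the other. *)

section \<open>Integer arithmetic for pseudoweights\<close>

definition doubled_value :: "nat \<Rightarrow> nat \<Rightarrow> int" where
  "doubled_value k a = (if a = 0 then int k else 2 * int a)"

definition doubled_weight :: "nat \<Rightarrow> nat list \<Rightarrow> int" where
  "doubled_weight k xs = sum_list (map (doubled_value k) xs)"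

lemma pseudoweight_eq_doubled_weight: "pseudoweight k xs = of_int (doubled_weight k xs) / 2"
proof -
  have "pseudoweight k xs = (\<Sum>i<length xs. of_int (doubled_value k (xs ! i)) / 2)"
    unfolding pseudoweight_def
    by (intro sum.cong) (auto simp: pseudovalue_def doubled_value_def)
  then show ?thesis
    by (simp add: doubled_weight_def sum_list_sum_nth sum_divide_distrib atLeast0LessThan)
qed

lemma doubled_weight_update:
  assumes "i < length xs"
  shows "doubled_weight k (xs[i := b])
    = doubled_weight k xs - doubled_value k (xs ! i) + doubled_value k b"
  using assms
proof (induction xs arbitrary: i)
  case (Cons x xs)
  then show ?case by (cases i) (simp_all add: doubled_weight_def)
qed simp

lemma doubled_weight_nonzero:
  assumes "0 \<notin> set xs"
  shows "doubled_weight k xs = 2 * int (sum_list xs)"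
  using assms by (induction xs) (auto simp: doubled_weight_def doubled_value_def)

lemma doubled_weight_rotate1 [simp]: "doubled_weight k (rotate1 xs) = doubled_weight k xs"
  by (cases xs) (auto simp: doubled_weight_def)

section \<open>Edges and their rotations\<close>

lemma arcs_pseudoweight_graph:
  "xs \<in> arcs (pseudoweight_graph k r s m) \<longleftrightarrow> length xs = Suc m \<and> set xs \<subseteq> {..<k}
     \<and> 2 * r \<le> doubled_weight k xs \<and> doubled_weight k xs \<le> 2 * s"
proof -
  have "of_int r \<le> pseudoweight k xs \<longleftrightarrow> (of_int (2 * r) :: rat) \<le> of_int (doubled_weight k xs)"
    "pseudoweight k xs \<le> of_int s \<longleftrightarrow> (of_int (doubled_weight k xs) :: rat) \<le> of_int (2 * s)"
    by (auto simp: pseudoweight_eq_doubled_weight field_simps)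
  then show ?thesis
    unfolding of_int_le_iff
    by (auto simp: pseudoweight_graph_def edge_subgraph_def de_bruijn_def tuples_def)
qed

lemma tail_pseudoweight_graph [simp]: "tail (pseudoweight_graph k r s m) = butlast"
  and head_pseudoweight_graph [simp]: "head (pseudoweight_graph k r s m) = tl"
  by (auto simp: pseudoweight_graph_def edge_subgraph_def de_bruijn_def)

lemma verts_pseudoweight_graph:
  "verts (pseudoweight_graph k r s m)
     = butlast ` arcs (pseudoweight_graph k r s m) \<union> tl ` arcs (pseudoweight_graph k r s m)"
  by (auto simp: pseudoweight_graph_def edge_subgraph_def de_bruijn_def)

lemma butlast_rotate1: "butlast (rotate1 xs) = tl xs"
  by (cases xs) auto

lemma rotate1_in_arcs [simp]:
  "rotate1 xs \<in> arcs (pseudoweight_graph k r s m) \<longleftrightarrow> xs \<in> arcs (pseudoweight_graph k r s m)"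
  by (simp add: arcs_pseudoweight_graph)

lemma rotate_in_arcs [simp]:
  "rotate j xs \<in> arcs (pseudoweight_graph k r s m) \<longleftrightarrow> xs \<in> arcs (pseudoweight_graph k r s m)"
  by (induction j) auto

lemma wf_digraph_pseudoweight_graph: "wf_digraph (pseudoweight_graph k r s m)"
  using subgraph_pseudoweight_graph by (auto simp: subgraph_def)

text \<open>Each rotation \<open>rotate j xs\<close> is itself an edge. Its head
  \<open>tl (rotate j xs)\<close> is the tail of the next rotation, so successive rotations form a
  walk.\<close>

lemma butlast_reachable_rotate:
  assumes "xs \<in> arcs (pseudoweight_graph k r s m)"
  shows "butlast xs \<rightarrow>\<^sup>*\<^bsub>pseudoweight_graph k r s m\<^esub> butlast (rotate j xs)"
proof (induction j)
  interpret wf_digraph "pseudoweight_graph k r s m" by (rule wf_digraph_pseudoweight_graph)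
  case 0
  show ?case using assms by (auto simp: verts_pseudoweight_graph)
next
  interpret wf_digraph "pseudoweight_graph k r s m" by (rule wf_digraph_pseudoweight_graph)
  case (Suc j)
  have "butlast (rotate j xs) \<rightarrow>\<^bsub>pseudoweight_graph k r s m\<^esub> butlast (rotate (Suc j) xs)"
    by (rule dominatesI[where a = "rotate j xs"])
      (use assms in \<open>auto simp: arc_to_ends_def butlast_rotate1\<close>)
  with Suc show ?case by (rule reachable_adj_trans)
qed

section \<open>Mutual reachability of edges\<close>

definition linked :: "('a, 'b) pre_digraph \<Rightarrow> 'b \<Rightarrow> 'b \<Rightarrow> bool" where
  "linked G x y \<longleftrightarrow> tail G x \<rightarrow>\<^sup>*\<^bsub>G\<^esub> tail G y \<and> tail G y \<rightarrow>\<^sup>*\<^bsub>G\<^esub> tail G x"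

lemma linked_sym: "linked G x y \<Longrightarrow> linked G y x"
  by (auto simp: linked_def)

lemma linked_trans [trans]: "wf_digraph G \<Longrightarrow> linked G x y \<Longrightarrow> linked G y z \<Longrightarrow> linked G x z"
  by (meson linked_def wf_digraph.reachable_trans)

text \<open>The walk through the rotations closes up: after \<open>j\<close> rotations, another
  \<open>m * j\<close> make a total of \<open>Suc m * j\<close>, a multiple of the length, which
  restores \<open>xs\<close>.\<close>

lemma linked_rotate:
  assumes "xs \<in> arcs (pseudoweight_graph k r s m)"
  shows "linked (pseudoweight_graph k r s m) xs (rotate j xs)"
proof -
  have len: "length xs = Suc m" using assms by (simp add: arcs_pseudoweight_graph)
  have "rotate (m * j) (rotate j xs) = rotate (length xs * j) xs"
    by (simp add: rotate_rotate len algebra_simps)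
  also have "\<dots> = xs" by simp
  finally have "rotate (m * j) (rotate j xs) = xs" .
  with assms butlast_reachable_rotate[of xs k r s m j]
    butlast_reachable_rotate[of "rotate j xs" k r s m "m * j"]
  show ?thesis by (simp add: linked_def)
qed

text \<open>Rotating by \<open>Suc i\<close> brings position \<open>i\<close> to the end, where
  \<open>butlast\<close> discards it. The two rotated tuples are therefore edges with the same tail,
  and each is linked to its own rotation.\<close>

lemma linked_update:
  assumes "xs \<in> arcs (pseudoweight_graph k r s m)"
    and "xs[i := b] \<in> arcs (pseudoweight_graph k r s m)"
    and "i < length xs"
  shows "linked (pseudoweight_graph k r s m) xs (xs[i := b])"
proof -
  let ?G = "pseudoweight_graph k r s m"
  interpret wf_digraph ?G by (rule wf_digraph_pseudoweight_graph)
  have rot: "rotate (Suc i) ys = drop (Suc i) ys @ take i ys @ [ys ! i]"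
    if "length ys = length xs" for ys :: "nat list"
  \<comment> \<open>Rotation by the full length is treated apart because
    \<open>rotate_drop_take\<close> reduces the rotation count modulo the length.\<close>
  proof (cases "Suc i = length ys")
    case True
    then show ?thesis by (simp flip: take_Suc_conv_app_nth)
  next
    case False
    with that assms(3) have "Suc i < length ys" by linarith
    then show ?thesis
      by (simp add: rotate_drop_take take_Suc_conv_app_nth del: rotate_Suc)
  qed
  have "butlast (rotate (Suc i) (xs[i := b])) = butlast (rotate (Suc i) xs)"
    unfolding rot[OF refl] rot[OF length_list_update] by (simp add: butlast_append)
  then have "linked ?G xs (rotate (Suc i) (xs[i := b]))"
    using linked_rotate[OF assms(1), of "Suc i"] by (simp only: linked_def tail_pseudoweight_graph)
  also have "linked ?G (rotate (Suc i) (xs[i := b])) (xs[i := b])"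
    by (rule linked_sym[OF linked_rotate[OF assms(2)]])
  finally (linked_trans[OF wf_digraph_axioms]) show ?thesis .
qed

section \<open>Connecting edges by changes of single digits\<close>

lemma linked_nonzero:
  assumes "odd k" "k > 2" and "xs \<in> arcs (pseudoweight_graph k r (r + 1) m)"
  obtains ys where "ys \<in> arcs (pseudoweight_graph k r (r + 1) m)" "0 \<notin> set ys"
    "linked (pseudoweight_graph k r (r + 1) m) xs ys"
proof -
  let ?G = "pseudoweight_graph k r (r + 1) m"
  interpret wf_digraph ?G by (rule wf_digraph_pseudoweight_graph)
  \<comment> \<open>Zeros are removed from left to right; \<open>j\<close> is the length of the
    prefix already cleared.\<close>
  have "\<exists>ys \<in> arcs ?G. linked ?G xs ys \<and> (\<forall>i<j. ys ! i \<noteq> 0)" if "j \<le> Suc m" for j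
    using that
  proof (induction j)
    case 0
    show ?case using assms(3) linked_rotate[of xs k r "r + 1" m 0] by auto
  next
    case (Suc j)
    then obtain ys where ys: "ys \<in> arcs ?G" "linked ?G xs ys" "\<forall>i<j. ys ! i \<noteq> 0" by auto
    have j: "j < length ys" using ys(1) Suc.prems by (simp add: arcs_pseudoweight_graph)
    show ?case
    proof (cases "ys ! j = 0")
      case False
      with ys show ?thesis by (auto simp: less_Suc_eq)
    next
      case True
      obtain h where h: "k = 2 * h + 1" using assms(1) by (elim oddE)
      \<comment> \<open>A zero has doubled value \<open>2 * h + 1\<close>, so \<open>h\<close>
        lowers the doubled weight by 1 and \<open>Suc h\<close> raises it by 1. Raising stays in
        range unless the weight is already at the upper bound. Since \<open>k > 2\<close>,
        \<open>h\<close> is not zero.\<close>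
      define b where "b = (if doubled_weight k ys = 2 * r + 2 then h else Suc h)"
      have b: "b \<noteq> 0" "b < k" using h assms(2) by (auto simp: b_def)
      have "doubled_weight k (ys[j := b])
          = (if doubled_weight k ys = 2 * r + 2 then 2 * r + 1 else doubled_weight k ys + 1)"
        using j True b h by (auto simp: doubled_weight_update doubled_value_def b_def)
      then have arc: "ys[j := b] \<in> arcs ?G"
        using ys(1) b set_update_subset_insert[of ys j b] by (auto simp: arcs_pseudoweight_graph)
      have "linked ?G xs (ys[j := b])"
        using linked_trans[OF wf_digraph_axioms ys(2) linked_update[OF ys(1) arc j]] .
      with arc ys(3) b j show ?thesis
        by (intro bexI[of _ "ys[j := b]"]) (auto simp: less_Suc_eq)
    qed
  qed
  from this[OF order_refl] obtain ys where "ys \<in> arcs ?G" "linked ?G xs ys" "\<forall>i<Suc m. ys ! i \<noteq> 0"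
    by blast
  moreover from this have "0 \<notin> set ys"
    by (auto simp: arcs_pseudoweight_graph in_set_conv_nth)
  ultimately show thesis using that by blast
qed

text \<open>Induction on the \<ell>1 distance of the two tuples. One digit change brings them closer
  while keeping both inside the graph and free of zeros.\<close>

lemma linked_if_nonzero:
  assumes "xs \<in> arcs (pseudoweight_graph k r (r + 1) m)"
    and "ys \<in> arcs (pseudoweight_graph k r (r + 1) m)"
    and "0 \<notin> set xs" "0 \<notin> set ys"
  shows "linked (pseudoweight_graph k r (r + 1) m) xs ys"
  using assms
proof (induction "\<Sum>i\<le>m. nat \<bar>int (xs ! i) - int (ys ! i)\<bar>" arbitrary: xs ys rule: less_induct)
  case less
  let ?G = "pseudoweight_graph k r (r + 1) m"
  let ?d = "\<lambda>xs ys. \<Sum>i\<le>m. nat \<bar>int (xs ! i) - int (ys ! i)\<bar>"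
  interpret wf_digraph ?G by (rule wf_digraph_pseudoweight_graph)
  \<comment> \<open>The induction hypothesis is made a premise so that the step can be applied with
    the two tuples in either order; the one with the smaller digit sum comes first.\<close>
  have step: "linked ?G xs ys"
    if IH: "\<And>us vs. \<lbrakk>?d us vs < ?d xs ys; us \<in> arcs ?G; vs \<in> arcs ?G; 0 \<notin> set us; 0 \<notin> set vs\<rbrakk>
        \<Longrightarrow> linked ?G us vs"
      and xs: "xs \<in> arcs ?G" "0 \<notin> set xs" and ys: "ys \<in> arcs ?G" "0 \<notin> set ys"
      and le: "sum_list xs \<le> sum_list ys" for xs ys
  proof (cases "xs = ys")
    case True
    then show ?thesis using linked_rotate[OF xs(1), of 0] by simp
  next
    case False
    have len: "length xs = Suc m" "length ys = Suc m"
      using xs ys by (auto simp: arcs_pseudoweight_graph)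
    have "\<exists>i\<le>m. xs ! i < ys ! i"
    proof (rule ccontr)
      assume "\<not> ?thesis"
      then have ge: "ys ! i \<le> xs ! i" if "i < Suc m" for i
        using that by (simp add: not_less less_Suc_eq_le)
      obtain i where "i < Suc m" "xs ! i \<noteq> ys ! i"
        using False len by (metis nth_equalityI)
      with ge have "(\<Sum>i<Suc m. ys ! i) < (\<Sum>i<Suc m. xs ! i)"
        by (intro sum_strict_mono_ex1) (auto intro!: bexI[of _ i] simp: le_neq_implies_less)
      with le len show False by (simp add: sum_list_sum_nth atLeast0LessThan)
    qed
    then obtain i where i: "i \<le> m" "xs ! i < ys ! i" by blast
    have ylt: "ys ! i < k" using ys(1) len i by (auto simp: arcs_pseudoweight_graph subset_iff)
    have xpos: "0 < xs ! i" using xs(2) len i by (metis gr0I le_imp_less_Suc nth_mem)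
    \<comment> \<open>Only position \<open>i\<close> may change, so the distance drops as soon as
      the gap there does.\<close>
    have closer: "?d us vs < ?d xs ys"
      if "\<And>j. j \<noteq> i \<Longrightarrow> us ! j = xs ! j \<and> vs ! j = ys ! j"
        "\<bar>int (us ! i) - int (vs ! i)\<bar> < int (ys ! i) - int (xs ! i)" for us vs
    proof (rule sum_strict_mono_ex1)
      show "\<forall>j\<in>{..m}. nat \<bar>int (us ! j) - int (vs ! j)\<bar> \<le> nat \<bar>int (xs ! j) - int (ys ! j)\<bar>"
      proof
        fix j show "nat \<bar>int (us ! j) - int (vs ! j)\<bar> \<le> nat \<bar>int (xs ! j) - int (ys ! j)\<bar>"
          using that(1)[of j] that(2) by (cases "j = i") auto
      qed
      show "\<exists>j\<in>{..m}. nat \<bar>int (us ! j) - int (vs ! j)\<bar> < nat \<bar>int (xs ! j) - int (ys ! j)\<bar>"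
        using that(2) i by (intro bexI[of _ i]) auto
    qed simp
    show ?thesis
    \<comment> \<open>With digit sum \<open>r\<close> there is room to raise \<open>xs\<close> at
      \<open>i\<close>; the new digit is at most \<open>ys ! i\<close>, hence below
      \<open>k\<close>.\<close>
    proof (cases "int (sum_list xs) = r")
      case True
      let ?us = "xs[i := Suc (xs ! i)]"
      have nz: "0 \<notin> set ?us" using xs(2) set_update_subset_insert[of xs i "Suc (xs ! i)"] by auto
      have "doubled_weight k ?us = 2 * r + 2"
        using i len xpos True doubled_weight_nonzero[OF xs(2)]
        by (simp add: doubled_weight_update doubled_value_def)
      then have arc: "?us \<in> arcs ?G"
        using xs(1) i ylt set_update_subset_insert[of xs i "Suc (xs ! i)"]
        by (auto simp: arcs_pseudoweight_graph)
      have "linked ?G xs ?us" using i len by (intro linked_update xs(1) arc) auto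
      moreover have "linked ?G ?us ys"
        using i len by (intro IH closer arc ys nz) auto
      ultimately show ?thesis by (rule linked_trans[OF wf_digraph_axioms])
    next
      case False
      \<comment> \<open>Here both digit sums equal \<open>r + 1\<close>, so \<open>ys\<close> can be
        lowered instead. The new digit is at least \<open>xs ! i\<close>, hence still
        positive.\<close>
      let ?vs = "ys[i := ys ! i - 1]"
      have nz: "0 \<notin> set ?vs"
        using ys(2) set_update_subset_insert[of ys i "ys ! i - 1"] i xpos by auto
      have "2 * r \<le> 2 * int (sum_list xs)" "2 * int (sum_list ys) \<le> 2 * (r + 1)"
        using xs ys doubled_weight_nonzero[of xs k] doubled_weight_nonzero[of ys k]
        by (auto simp: arcs_pseudoweight_graph)
      moreover have "int (sum_list xs) \<le> int (sum_list ys)" using le by simp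
      moreover have "r < int (sum_list xs)" using False calculation(1) by simp
      ultimately have "int (sum_list ys) = r + 1" by simp
      then have "doubled_weight k ?vs = 2 * r"
        using i len xpos doubled_weight_nonzero[OF ys(2), of k]
        by (simp add: doubled_weight_update doubled_value_def)
      then have arc: "?vs \<in> arcs ?G"
        using ys(1) i ylt set_update_subset_insert[of ys i "ys ! i - 1"]
        by (auto simp: arcs_pseudoweight_graph)
      have "linked ?G xs ?vs"
        using i len by (intro IH closer arc xs nz) auto
      moreover have "linked ?G ys ?vs" using i len by (intro linked_update ys(1) arc) auto
      ultimately show ?thesis by (rule linked_trans[OF wf_digraph_axioms _ linked_sym])
    qed
  qed
  have sym: "?d xs ys = ?d ys xs" by (simp add: abs_minus_commute)
  show ?case
  proof (cases "sum_list xs \<le> sum_list ys")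
    case True
    show ?thesis by (rule step[OF less.hyps less.prems(1,3,2,4) True])
  next
    case False
    then have le: "sum_list ys \<le> sum_list xs" by simp
    have "linked ?G ys xs" by (rule step[OF less.hyps[unfolded sym] less.prems(2,4,1,3) le])
    then show ?thesis by (rule linked_sym)
  qed
qed

section \<open>Nonemptiness, balance and strong connectivity\<close>

lemma exists_list_with_sum:
  fixes c :: nat
  assumes "n \<le> s" "s \<le> c * n"
  shows "\<exists>xs. length xs = n \<and> set xs \<subseteq> {1..c} \<and> sum_list xs = s"
  using assms
proof (induction n arbitrary: s)
  case 0
  then show ?case by simp
next
  case (Suc n)
  have c: "1 \<le> c" using Suc.prems by (cases c) auto
  \<comment> \<open>Greedy choice: the first entry is as large as possible while leaving at least 1
    for each of the other \<open>n\<close> entries.\<close>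
  define a where "a = min c (s - n)"
  have "n \<le> c * n" using c by simp
  then have "n \<le> s - a" "s - a \<le> c * n" using Suc.prems by (auto simp: a_def min_def)
  from Suc.IH[OF this] obtain xs where "length xs = n" "set xs \<subseteq> {1..c}" "sum_list xs = s - a"
    by blast
  moreover have "1 \<le> a" "a \<le> c" "a \<le> s" using c Suc.prems by (auto simp: a_def)
  ultimately show ?case by (intro exI[of _ "a # xs"]) auto
qed

text \<open>The tail of \<open>rotate1 xs\<close> is the head of \<open>xs\<close>, so
  \<open>rotate1\<close> maps the edges entering a vertex bijectively onto those leaving it.\<close>

lemma balanced_pseudoweight_graph: "balanced (pseudoweight_graph k r s m)"
  unfolding balanced_def in_degree_def out_degree_def
proof
  fix v
  let ?G = "pseudoweight_graph k r s m"
  have "rotate1 ` in_arcs ?G v = out_arcs ?G v"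
  proof
    show "rotate1 ` in_arcs ?G v \<subseteq> out_arcs ?G v"
      by (auto simp: in_arcs_def out_arcs_def butlast_rotate1)
    show "out_arcs ?G v \<subseteq> rotate1 ` in_arcs ?G v"
    proof
      fix ys assume ys: "ys \<in> out_arcs ?G v"
      obtain xs where "ys = rotate1 xs" by (metis surj_rotate1 surjD)
      with ys show "ys \<in> rotate1 ` in_arcs ?G v"
        by (auto simp: in_arcs_def out_arcs_def butlast_rotate1)
    qed
  qed
  moreover have "inj_on rotate1 (in_arcs ?G v)" by (rule inj_on_subset[OF inj_rotate1]) simp
  ultimately show "card (in_arcs ?G v) = card (out_arcs ?G v)" by (metis card_image)
qed

theorem theorem5p8:
  fixes n k :: nat and r :: int
  assumes "n \<ge> 2" and "k > 2" and "odd k"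
    and "int n \<le> r" and "r < (int k - 1) * int n"
  shows "eulerian (pseudoweight_graph k r (r + 1) (n - 1))"
proof -
  let ?G = "pseudoweight_graph k r (r + 1) (n - 1)"
  interpret wf_digraph ?G by (rule wf_digraph_pseudoweight_graph)
  have linked: "linked ?G xs ys" if arcs: "xs \<in> arcs ?G" "ys \<in> arcs ?G" for xs ys
  proof -
    obtain us where us: "us \<in> arcs ?G" "0 \<notin> set us" "linked ?G xs us"
      using linked_nonzero[OF assms(3,2) arcs(1)] .
    obtain vs where vs: "vs \<in> arcs ?G" "0 \<notin> set vs" "linked ?G ys vs"
      using linked_nonzero[OF assms(3,2) arcs(2)] .
    note us(3)
    also have "linked ?G us vs" using us vs by (intro linked_if_nonzero)
    also (linked_trans[OF wf_digraph_axioms]) have "linked ?G vs ys" using vs(3) by (rule linked_sym)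
    finally (linked_trans[OF wf_digraph_axioms]) show ?thesis .
  qed
  \<comment> \<open>The bounds on \<open>r\<close> allow \<open>n\<close> nonzero digits with sum
    exactly \<open>r\<close>; such a tuple is an edge, so the graph is nonempty.\<close>
  have "int (nat r) \<le> int ((k - 1) * n)" using assms by simp
  then have "nat r \<le> (k - 1) * n" by linarith
  moreover have "n \<le> nat r" using assms by linarith
  ultimately obtain xs where xs: "length xs = n" "set xs \<subseteq> {1..k - 1}" "sum_list xs = nat r"
    using exists_list_with_sum by metis
  then have "0 \<notin> set xs" by auto
  then have "doubled_weight k xs = 2 * r" using xs assms by (simp add: doubled_weight_nonzero)
  moreover have "set xs \<subseteq> {..<k}" using xs(2) assms(2) by fastforce
  ultimately have arc: "xs \<in> arcs ?G" using xs(1) assms(1) by (simp add: arcs_pseudoweight_graph)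
  \<comment> \<open>Since \<open>linked\<close> speaks only of tails, every vertex has to be shown
    to be one: the head of an edge is the tail of its rotation.\<close>
  have tail: "\<exists>xs \<in> arcs ?G. v = butlast xs" if "v \<in> verts ?G" for v
  proof -
    from that consider xs where "xs \<in> arcs ?G" "v = butlast xs" | xs where "xs \<in> arcs ?G" "v = tl xs"
      unfolding verts_pseudoweight_graph by blast
    then show ?thesis
    proof cases
      case (2 xs)
      then show ?thesis by (intro bexI[of _ "rotate1 xs"]) (simp_all add: butlast_rotate1)
    qed auto
  qed
  have "strongly_connected ?G"
  proof (rule strongly_connectedI)
    show "verts ?G \<noteq> {}" using arc by (auto simp: verts_pseudoweight_graph)
    show "u \<rightarrow>\<^sup>*\<^bsub>?G\<^esub> v" if "u \<in> verts ?G" "v \<in> verts ?G" for u v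
      using tail[OF that(1)] tail[OF that(2)] linked by (auto simp: linked_def)
  qed
  with balanced_pseudoweight_graph show ?thesis by (simp add: eulerian_def)
qed

end
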